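(* Let $\alpha\in\mathbb{R}^{d_2}$ with $\alpha_i>0$ for all $i$ and $\sum_{i=1}^{d_2}\alpha_i=1$, let $\mathcal{K}_{\mathrm{rpower}}\subset\mathbb{R}^{d_1}\times\mathbb{R}^{d_2}$ be the radial power cone parametrized by $\alpha$ with barrier $f$, and let $g^\ast$ be its conjugate gradient (all defined in the context). The conjugate gradient $g^\ast$ at $(p,r)\in\operatorname{int}(\mathcal{K}_{\mathrm{rpower}}^\ast)$ is given by $$g^\ast_{p_i}=1_{p\neq0}\cdot\hat y\,\frac{p_i}{\|p\|}\quad(i=1,\dots,d_1),\qquad g^\ast_{r_i}=-\frac{\alpha_i(1+\|p\|\hat y)+1}{r_i}\quad(i=1,\dots,d_2),$$ where $\hat y$ is the (unique) positive root of $$h(y)=\sum_{i=1}^{d_2}2\alpha_i\log\Bigl(2\alpha_iy^2+\tfrac{2y(1+\alpha_i)}{\|p\|}\Bigr)-\log(\varphi(r))-\log\Bigl(\tfrac{2y}{\|p\|}+y^2\Bigr)-2\log\Bigl(\tfrac{2y}{\|p\|}\Bigr),$$ and for $p=0$ the product $\|p\|\hat y$ is read as $0$. In the case where $d_1=1$ and $\alpha_i=1/d_2$ for all $i$ (so that the cone is the radial geometric mean cone $\mathcal{K}_{\mathrm{rgeom}}$), the conjugate gradient at $(p,r)\in\operatorname{int}(\mathcal{K}_{\mathrm{rgeom}}^\ast)$ is $$g^\ast_p=y_-,\qquad\text{where}\quad y_-=-p^{-1}+d_2\,\frac{p+\sqrt{\varphi(r)\bigl(\tfrac{d_2^2}{p^2}\varphi(r)+d_2^2-1\bigr)}}{\varphi(r)d_2^2-p^2},$$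 $$g^\ast_{r_i}=-r_i^{-1}\left(\frac{p^2+\sqrt{\varphi(r)(d_2^2\varphi(r)+d_2^2p^2-p^2)}}{\varphi(r)d_2^2-p^2}+1\right)\quad(i=1,\dots,d_2).$$
   Context: For a closed, convex, pointed, full-dimensional cone $\mathcal{K}$ in a finite-dimensional real inner product space, the dual cone is $\mathcal{K}^\ast=\{s:\langle w,s\rangle\ge 0\ \forall w\in\mathcal{K}\}$. Given a logarithmically homogeneous self-concordant barrier $f:\operatorname{int}(\mathcal{K})\to\mathbb{R}$, the conjugate barrier is $f^\ast(s)=\sup_{w\in\operatorname{int}(\mathcal{K})}\{-\langle s,w\rangle-f(w)\}$, and the conjugate gradient $g^\ast$ is the gradient of $f^\ast$; equivalently $g^\ast(s)=-\operatorname{argsup}_{w\in\operatorname{int}(\mathcal{K})}\{-\langle s,w\rangle-f(w)\}$. Here $\langle\cdot,\cdot\rangle$ is the standard inner product, $\|\cdot\|$ is the Euclidean norm, and $1_P$ equals one if the statement $P$ is true and zero otherwise. Let $\varphi(w)=\prod_{i=1}^{d_2}w_i^{2\alpha_i}$. The radial power cone is $\mathcal{K}_{\mathrm{rpower}}=\{(u,w)\in\mathbb{R}^{d_1}\times\mathbb{R}^{d_2}_+:\|u\|\le\prod_{i=1}^{d_2}w_i^{\alpha_i}=\sqrt{\varphi(w)}\}$, with barrier $f(u,w)=-\log(\varphi(w)-\|u\|^2)-\sum_{i=1}^{d_2}(1-\alpha_i)\log(w_i)$. Its dual cone is $\mathcal{K}_{\mathrm{rpower}}^\ast=\{(p,r)\in\mathbb{R}^{d_1}\times\mathbb{R}^{d_2}_+:\|p\|\le\prod_{i=1}^{d_2}(r_i/\alpha_i)^{\alpha_i}\}$.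 The radial geometric mean cone $\mathcal{K}_{\mathrm{rgeom}}$ is the special case of $\mathcal{K}_{\mathrm{rpower}}$ with $d_1=1$ and $\alpha_i=1/d_2$ for all $i$. Subscripts $p_i,r_i$ (or $p$ when $d_1=1$) on $g^\ast$ denote the corresponding components of $g^\ast(p,r)$.
   Formalization: The printed y_- is undefined at p=0 and false for p<0 (d_2=1, p=-1, r=2: true value -2/3, printed value 2); the formal statement asserts g*_p=y_-(p) for p>0, g*_p=0 for p=0, and g*_p=-y_-(-p) for p<0. *)

theory Defs
  imports "HOL-Analysis.Analysis"
begin

definition dual_cone :: "'a::real_inner set \<Rightarrow> 'a set" where
  "dual_cone K = {s. \<forall>w\<in>K. w \<bullet> s \<ge> 0}"

(* The supremum is the one of type real, hence only meaningful where it is finite;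
   for a logarithmically homogeneous self-concordant barrier of a proper cone this is
   the case on the interior of the dual cone. *)
definition conjugate_barrier :: "'a::real_inner set \<Rightarrow> ('a \<Rightarrow> real) \<Rightarrow> 'a \<Rightarrow> real" where
  "conjugate_barrier K f s = (SUP w\<in>interior K. - (s \<bullet> w) - f w)"

definition conjugate_gradient :: "'a::real_inner set \<Rightarrow> ('a \<Rightarrow> real) \<Rightarrow> 'a \<Rightarrow> 'a" where
  "conjugate_gradient K f s = (THE g. GDERIV (conjugate_barrier K f) s :> g)"

definition power_prod :: "real ^ 'n \<Rightarrow> real ^ 'n \<Rightarrow> real" where
  "power_prod \<alpha> w = (\<Prod>i\<in>UNIV. (w $ i) powr (2 * \<alpha> $ i))"

(* The radial geometric mean cone is the case CARD('m) = 1, \<alpha> $ i = 1 / CARD('n). *)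
definition rpower_cone :: "real ^ 'n \<Rightarrow> ((real ^ 'm) \<times> (real ^ 'n)) set" where
  "rpower_cone \<alpha> =
     {(u, w). (\<forall>i. w $ i \<ge> 0) \<and> norm u \<le> (\<Prod>i\<in>UNIV. (w $ i) powr (\<alpha> $ i))}"

definition rpower_barrier :: "real ^ 'n \<Rightarrow> (real ^ 'm) \<times> (real ^ 'n) \<Rightarrow> real" where
  "rpower_barrier \<alpha> = (\<lambda>(u, w). - ln (power_prod \<alpha> w - (norm u)\<^sup>2)
     - (\<Sum>i\<in>UNIV. (1 - \<alpha> $ i) * ln (w $ i)))"

definition rpower_h :: "real ^ 'n \<Rightarrow> real ^ 'm \<Rightarrow> real ^ 'n \<Rightarrow> real \<Rightarrow> real" where
  "rpower_h \<alpha> p r y =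
     (\<Sum>i\<in>UNIV. 2 * \<alpha> $ i * ln (2 * \<alpha> $ i * y\<^sup>2 + 2 * y * (1 + \<alpha> $ i) / norm p))
     - ln (power_prod \<alpha> r) - ln (2 * y / norm p + y\<^sup>2) - 2 * ln (2 * y / norm p)"

(* Only meaningful for p \<noteq> 0. *)
definition rpower_root :: "real ^ 'n \<Rightarrow> real ^ 'm \<Rightarrow> real ^ 'n \<Rightarrow> real" where
  "rpower_root \<alpha> p r = (THE y. y > 0 \<and> rpower_h \<alpha> p r y = 0)"

(* The parameter \<phi> stands for power_prod \<alpha> r, and d for the number of components of r.
   The formula is the p-component of the conjugate gradient for p > 0 only: since
   sqrt (\<phi> * (d\<^sup>2 / p\<^sup>2 * \<phi> + d\<^sup>2 - 1)) is sqrt (\<phi> * (d\<^sup>2 * \<phi> + d\<^sup>2 * p\<^sup>2 - p\<^sup>2)) / \<bar>p\<bar>,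
   it selects the wrong root of the underlying quadratic equation if p < 0.  That component
   is an odd function of p, which determines it for p \<le> 0. *)
definition rgeom_y_minus :: "real \<Rightarrow> real \<Rightarrow> real \<Rightarrow> real" where
  "rgeom_y_minus d \<phi> p = - inverse p
     + d * ((p + sqrt (\<phi> * (d\<^sup>2 / p\<^sup>2 * \<phi> + d\<^sup>2 - 1))) / (\<phi> * d\<^sup>2 - p\<^sup>2))"

end

theory Submission
  imports Defs
begin

text \<open>
  The conjugate gradient at \<open>s = (p, r)\<close> is the negated maximizer of
  \<open>- s \<bullet> w - f w\<close>. Setting the gradient of this function to zero forces the maximizer to have the
  form \<open>u = - \<eta> p\<close> and \<open>w\<^sub>i = (\<alpha>\<^sub>i (1 + \<eta> \<parallel>p\<parallel>\<^sup>2) + 1) / r\<^sub>i\<close> with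
  \<open>\<phi>(w) - \<parallel>u\<parallel>\<^sup>2 = 2 \<eta>\<close>. Writing \<open>y = \<eta> \<parallel>p\<parallel>\<close>, the last condition becomes
  \<open>\<phi>(w) = y\<^sup>2 + 2 y / \<parallel>p\<parallel>\<close>, whose logarithm is \<open>h y = 0\<close>.

  That such a point is a global maximizer follows from tangent bounds for the logarithm and the
  weighted AM-GM inequality (\<open>rpower_barrier_max\<close>). The existence of exactly one root comes from
  rewriting the equation in \<open>x = \<parallel>p\<parallel> y\<close>, as
  \<open>x (x + 2) / (\<Prod>i. (\<alpha>\<^sub>i (1 + x) + 1) powr (2 \<alpha>\<^sub>i)) = \<parallel>p\<parallel>\<^sup>2 / \<phi>(r)\<close>. The left side increases
  strictly from \<open>0\<close> to \<open>1 / (\<Prod>i. \<alpha>\<^sub>i powr (2 \<alpha>\<^sub>i))\<close>, and on the interior of the dual cone the right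
  side lies in this range. Since \<open>x\<close> depends continuously on the right side, even at \<open>p = 0\<close>, so
  does the maximizer on \<open>(p, r)\<close>, and an envelope argument (\<open>GDERIV_conjugate_barrier\<close>) identifies
  the gradient of the conjugate barrier.

  For equal weights the product over \<open>i\<close> collapses to a square, the root equation becomes
  quadratic, and solving it gives the closed formulas.
\<close>

section \<open>Conjugate gradients as negated maximizers\<close>

lemma conjugate_barrier_eq_max:
  assumes "W \<in> interior K"
    and "\<And>w. w \<in> interior K \<Longrightarrow> - (s \<bullet> w) - f w \<le> - (s \<bullet> W) - f W"
  shows "conjugate_barrier K f s = - (s \<bullet> W) - f W"
  unfolding conjugate_barrier_def using assms by (intro cSup_eq_maximum) auto

text \<open>
  This is Danskin's envelope theorem, without convex analysis. Testing the maximality of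
  \<open>W t\<close> against \<open>W s\<close>, and conversely, encloses the error of the linear approximation between
  \<open>0\<close> and \<open>\<parallel>t - s\<parallel> \<parallel>W t - W s\<parallel>\<close>, so continuity of the maximizers is all that
  differentiability requires.
\<close>

lemma GDERIV_conjugate_barrier:
  assumes S: "open S" "s \<in> S"
    and W: "\<And>t. t \<in> S \<Longrightarrow> W t \<in> interior K"
    and max: "\<And>t w. t \<in> S \<Longrightarrow> w \<in> interior K \<Longrightarrow> - (t \<bullet> w) - f w \<le> - (t \<bullet> W t) - f (W t)"
    and cont: "isCont W s"
  shows "GDERIV (conjugate_barrier K f) s :> - W s"
proof -
  let ?F = "conjugate_barrier K f"
  have F: "?F t = - (t \<bullet> W t) - f (W t)" if "t \<in> S" for t
    using that W max by (intro conjugate_barrier_eq_max) auto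
  have bound: "norm (?F t - ?F s - (t - s) \<bullet> (- W s)) / norm (t - s) \<le> norm (W t - W s)"
    if t: "t \<in> S" for t
  proof -
    have lo: "0 \<le> ?F t - ?F s - (t - s) \<bullet> (- W s)"
      using max[OF t W[OF S(2)]] F[OF t] F[OF S(2)] by (simp add: inner_diff_left)
    have "?F t - ?F s - (t - s) \<bullet> (- W s) \<le> - ((t - s) \<bullet> (W t - W s))"
      using max[OF S(2) W[OF t]] F[OF t] F[OF S(2)] by (simp add: inner_diff_left inner_diff_right)
    also have "\<dots> \<le> norm (t - s) * norm (W t - W s)"
      using Cauchy_Schwarz_ineq2[of "t - s" "W t - W s"] by linarith
    finally show ?thesis
      using lo by (cases "t = s") (auto simp: divide_le_eq mult.commute)
  qed
  have ev: "\<forall>\<^sub>F t in at s. t \<in> S"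
    using S eventually_at_topological by blast
  have "((\<lambda>t. norm (W t - W s)) \<longlongrightarrow> 0) (at s)"
    using cont by (simp add: isCont_def LIM_zero tendsto_norm_zero)
  with eventually_mono[OF ev bound]
  have "((\<lambda>t. norm (?F t - ?F s - (t - s) \<bullet> (- W s)) / norm (t - s)) \<longlongrightarrow> 0) (at s)"
    by (rule tendsto_sandwich[rotated, OF _ tendsto_const]) auto
  then show ?thesis
    unfolding gderiv_def has_derivative_iff_norm
    using bounded_linear_inner_left by blast
qed

lemma conjugate_gradient_eqI:
  assumes "GDERIV (conjugate_barrier K f) s :> g"
  shows "conjugate_gradient K f s = g"
  unfolding conjugate_gradient_def
proof (rule the_equality)
  show "GDERIV (conjugate_barrier K f) s :> g" by (fact assms)
next
  fix g' assume "GDERIV (conjugate_barrier K f) s :> g'"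
  then have "(\<lambda>h. h \<bullet> g') = (\<lambda>h. h \<bullet> g)"
    using assms unfolding gderiv_def by (rule has_derivative_unique)
  then have "(g' - g) \<bullet> (g' - g) = 0"
    by (metis inner_diff_right diff_self)
  then show "g' = g" by simp
qed

text \<open>
  An interior point of the dual cone stays in it after a small step in the direction \<open>- w\<close>,
  and that step lowers the inner product with \<open>w\<close>.
\<close>

lemma interior_dual_cone_inner_pos:
  assumes "s \<in> interior (dual_cone K)" "w \<in> K" "w \<noteq> 0"
  shows "0 < w \<bullet> s"
proof -
  obtain e where e: "e > 0" "cball s e \<subseteq> dual_cone K"
    using assms(1) by (meson mem_interior_cball)
  let ?t = "s - (e / norm w) *\<^sub>R w"
  have "?t \<in> cball s e" using e(1) assms(3) by (simp add: dist_norm)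
  then have "?t \<in> dual_cone K" using e(2) by blast
  then have "0 \<le> w \<bullet> ?t" using assms(2) by (simp add: dual_cone_def)
  also have "\<dots> < w \<bullet> s" using e(1) assms(3) by (simp add: inner_diff_right)
  finally show ?thesis .
qed

section \<open>Weighted geometric means\<close>

abbreviation weighted_gmean :: "real ^ 'n \<Rightarrow> real ^ 'n \<Rightarrow> real" where
  "weighted_gmean \<alpha> w \<equiv> \<Prod>i\<in>UNIV. (w $ i) powr (\<alpha> $ i)"

lemma weighted_gmean_power2: "(weighted_gmean \<alpha> w)\<^sup>2 = power_prod \<alpha> w"
proof -
  have *: "(a powr b)\<^sup>2 = a powr (2 * b)" for a b :: real
    by (simp add: power2_eq_square flip: powr_add)
  show ?thesis by (simp add: power_prod_def prod_power_distrib *)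
qed

lemma power_prod_pos: "(\<And>i. 0 < w $ i) \<Longrightarrow> 0 < power_prod \<alpha> w"
  unfolding power_prod_def by (intro prod_pos) (simp add: less_imp_neq[symmetric])

lemma ln_power_prod:
  assumes "\<And>i. 0 < w $ i"
  shows "ln (power_prod \<alpha> w) = (\<Sum>i\<in>UNIV. 2 * \<alpha> $ i * ln (w $ i))"
  using assms unfolding power_prod_def
  by (subst ln_prod) (auto simp: ln_powr less_imp_neq[symmetric])

lemma power_prod_divide:
  assumes "\<And>i. 0 < a $ i" "\<And>i. 0 < b $ i"
  shows "power_prod \<alpha> (\<chi> i. a $ i / b $ i) = power_prod \<alpha> a / power_prod \<alpha> b"
  using assms by (simp add: power_prod_def powr_divide prod_dividef less_imp_le)

lemma power_prod_mult:
  assumes "\<And>i. 0 < a $ i" "\<And>i. 0 < b $ i"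
  shows "power_prod \<alpha> (\<chi> i. a $ i * b $ i) = power_prod \<alpha> a * power_prod \<alpha> b"
  using assms by (simp add: power_prod_def powr_mult prod.distrib less_imp_le)

lemma continuous_on_power_prod:
  assumes "continuous_on S w" "\<And>s i. s \<in> S \<Longrightarrow> 0 < w s $ i"
  shows "continuous_on S (\<lambda>s. power_prod \<alpha> (w s))"
  unfolding power_prod_def
  using assms by (intro continuous_intros) (auto simp: less_imp_neq[symmetric])

context
  fixes \<alpha> :: "real ^ 'n"
  assumes \<alpha>_pos: "\<And>i. 0 < \<alpha> $ i" and \<alpha>_sum: "(\<Sum>i\<in>UNIV. \<alpha> $ i) = 1"
begin

lemma weight_le_1: "\<alpha> $ i \<le> 1"
  using member_le_sum[of i UNIV "\<lambda>i. \<alpha> $ i"] \<alpha>_pos \<alpha>_sum by (simp add: less_imp_le)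

lemma power_prod_const:
  assumes "0 < k"
  shows "power_prod \<alpha> (\<chi> i. k) = k\<^sup>2"
proof -
  have "power_prod \<alpha> (\<chi> i. k) = k powr (\<Sum>i\<in>UNIV. 2 * \<alpha> $ i)"
    using assms unfolding power_prod_def by (subst powr_sum) auto
  also have "\<dots> = k\<^sup>2" using assms by (simp add: \<alpha>_sum powr_numeral flip: sum_distrib_left)
  finally show ?thesis .
qed

lemma power_prod_scale:
  assumes "0 < k" "\<And>i. 0 < w $ i"
  shows "power_prod \<alpha> (\<chi> i. k * w $ i) = k\<^sup>2 * power_prod \<alpha> w"
  using power_prod_mult[of "\<chi> i. k" w \<alpha>] power_prod_const[of k] assms by simp

text \<open>
  Sum the bounds \<open>ln (t\<^sub>i / S) \<le> t\<^sub>i / S - 1\<close>, where \<open>S\<close> is the arithmetic mean.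
\<close>

lemma weighted_am_gm:
  assumes "\<And>i. 0 < t $ i"
  shows "weighted_gmean \<alpha> t \<le> (\<Sum>i\<in>UNIV. \<alpha> $ i * t $ i)"
proof -
  define S where "S = (\<Sum>i\<in>UNIV. \<alpha> $ i * t $ i)"
  have S: "0 < S" unfolding S_def using assms \<alpha>_pos by (intro sum_pos) auto
  have G: "0 < weighted_gmean \<alpha> t" by (intro prod_pos) (simp add: assms less_imp_neq[symmetric])
  have "ln (weighted_gmean \<alpha> t) - ln S = (\<Sum>i\<in>UNIV. \<alpha> $ i * (ln (t $ i) - ln S))"
    using assms
    by (simp add: ln_prod ln_powr less_imp_neq[symmetric] algebra_simps sum_subtractf \<alpha>_sum
        flip: sum_distrib_left)
  also have "\<dots> \<le> (\<Sum>i\<in>UNIV. \<alpha> $ i * (t $ i / S - 1))"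
  proof (intro sum_mono mult_left_mono)
    fix i show "ln (t $ i) - ln S \<le> t $ i / S - 1"
      using ln_le_minus_one[of "t $ i / S"] S assms[of i] by (simp add: ln_div)
    show "0 \<le> \<alpha> $ i" using \<alpha>_pos[of i] by simp
  qed
  also have "\<dots> = (\<Sum>i\<in>UNIV. \<alpha> $ i * t $ i) / S - 1"
    by (simp add: algebra_simps sum_subtractf \<alpha>_sum sum_divide_distrib)
  also have "\<dots> = 0" using S by (simp add: S_def)
  finally have "ln (weighted_gmean \<alpha> t) \<le> ln S" by simp
  then show ?thesis using G S by (simp add: S_def)
qed

section \<open>Interiors of the radial power cone and of its dual\<close>

lemma interior_rpower_cone:
  "interior (rpower_cone \<alpha> :: ((real ^ 'm) \<times> (real ^ 'n)) set) =
     {(u, w). (\<forall>i. 0 < w $ i) \<and> norm u < weighted_gmean \<alpha> w}" (is "interior ?K = ?G")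
proof
  let ?P = "UNIV \<times> {w. \<forall>i. 0 < w $ i} :: ((real ^ 'm) \<times> (real ^ 'n)) set"
  have "open {w :: real ^ 'n. \<forall>i. 0 < w $ i}"
    unfolding Collect_all_eq
    by (intro open_INT) (auto intro!: open_Collect_less continuous_intros)
  then have "open ?P" by (simp add: open_Times)
  moreover have "continuous_on ?P (\<lambda>z. weighted_gmean \<alpha> (snd z) - norm (fst z))"
    by (intro continuous_intros) (auto simp: less_imp_neq[symmetric])
  ultimately have "open (?P \<inter> (\<lambda>z. weighted_gmean \<alpha> (snd z) - norm (fst z)) -` {0<..})"
    by (intro continuous_open_preimage) auto
  also have "?P \<inter> (\<lambda>z. weighted_gmean \<alpha> (snd z) - norm (fst z)) -` {0<..} = ?G" by auto
  finally show "?G \<subseteq> interior ?K"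
    by (rule interior_maximal[rotated]) (auto simp: rpower_cone_def less_imp_le)
next
  show "interior ?K \<subseteq> ?G"
  proof
    fix z assume z: "z \<in> interior ?K"
    obtain u w where uw: "z = (u, w)" by force
    obtain e where e: "e > 0" "cball z e \<subseteq> ?K" using z by (meson mem_interior_cball)
    have pos: "0 < w $ i" for i
    proof -
      have "z - (0, e *\<^sub>R axis i 1) \<in> cball z e"
        using e by (simp add: dist_norm norm_Pair)
      then have "(u, w - e *\<^sub>R axis i 1) \<in> ?K" using e(2) by (auto simp: uw)
      then have "0 \<le> (w - e *\<^sub>R axis i 1) $ i" unfolding rpower_cone_def by blast
      then show ?thesis using e(1) by simp
    qed
    have "norm u < weighted_gmean \<alpha> w"
    proof (cases "u = 0")
      case True
      then show ?thesis using pos by (auto intro!: prod_pos simp: less_imp_neq[symmetric])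
    next
      case False
      have "z + ((e / norm u) *\<^sub>R u, 0) \<in> cball z e"
        using e False by (simp add: dist_norm norm_Pair)
      then have "(u + (e / norm u) *\<^sub>R u, w) \<in> ?K" using e(2) by (auto simp: uw)
      then have "norm ((1 + e / norm u) *\<^sub>R u) \<le> weighted_gmean \<alpha> w"
        by (simp add: rpower_cone_def scaleR_add_left)
      moreover have "norm ((1 + e / norm u) *\<^sub>R u) = norm u + e"
        unfolding norm_scaleR using e(1) False by (simp add: abs_of_pos add_pos_pos distrib_right)
      ultimately show ?thesis using e(1) by simp
    qed
    then show "z \<in> ?G" using pos uw by simp
  qed
qed

text \<open>
  The second inequality is the square of \<open>\<parallel>p\<parallel> < (\<Prod>i. (r\<^sub>i / \<alpha>\<^sub>i) powr \<alpha>\<^sub>i)\<close>. It results from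
  pairing \<open>(p, r)\<close> with the boundary point of the primal cone whose \<open>w\<close>-part is \<open>\<alpha>\<^sub>i / r\<^sub>i\<close> and
  whose \<open>u\<close>-part points opposite to \<open>p\<close>; this is the point for which the weighted
  AM-GM inequality in \<open>(r\<^sub>i w\<^sub>i / \<alpha>\<^sub>i)\<close> is tight.
\<close>

lemma interior_dual_rpower_cone_subset:
  assumes "(p, r) \<in> interior (dual_cone (rpower_cone \<alpha> :: ((real ^ 'm) \<times> (real ^ 'n)) set))"
  shows "0 < r $ i" and "(norm p)\<^sup>2 * power_prod \<alpha> \<alpha> < power_prod \<alpha> r"
proof -
  let ?K = "rpower_cone \<alpha> :: ((real ^ 'm) \<times> (real ^ 'n)) set"
  show r: "0 < r $ i" for i
  proof -
    have "(0, axis i 1) \<in> ?K"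
      by (auto simp: rpower_cone_def axis_def intro!: prod_nonneg)
    then have "0 < (0, axis i 1) \<bullet> (p, r)"
      by (rule interior_dual_cone_inner_pos[OF assms])
         (simp add: zero_prod_def axis_eq_0_iff)
    then show ?thesis by (simp add: inner_axis')
  qed
  define G where "G = weighted_gmean \<alpha> (\<chi> i. \<alpha> $ i / r $ i)"
  have G: "0 < G" "G\<^sup>2 = power_prod \<alpha> \<alpha> / power_prod \<alpha> r"
    unfolding G_def weighted_gmean_power2 using r \<alpha>_pos
    by (auto intro!: prod_pos simp: power_prod_divide less_imp_neq[symmetric])
  show "(norm p)\<^sup>2 * power_prod \<alpha> \<alpha> < power_prod \<alpha> r"
  proof -
    have "norm (- (G *\<^sub>R sgn p)) \<le> weighted_gmean \<alpha> (\<chi> i. \<alpha> $ i / r $ i)"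
      unfolding G_def[symmetric] using G(1) by (simp add: norm_sgn)
    then have "(- (G *\<^sub>R sgn p), \<chi> i. \<alpha> $ i / r $ i) \<in> ?K"
      using r \<alpha>_pos unfolding rpower_cone_def by (simp add: less_imp_le)
    moreover have "(\<chi> i. \<alpha> $ i / r $ i) \<noteq> 0"
      using r \<alpha>_pos by (auto simp: vec_eq_iff less_imp_neq[symmetric])
    ultimately have "0 < (- (G *\<^sub>R sgn p), \<chi> i. \<alpha> $ i / r $ i) \<bullet> (p, r)"
      by (intro interior_dual_cone_inner_pos[OF assms]) (auto simp: zero_prod_def)
    also have "sgn p \<bullet> p = norm p"
      by (cases "p = 0")
         (simp_all add: sgn_div_norm power2_norm_eq_inner[symmetric] power2_eq_square)
    then have "(- (G *\<^sub>R sgn p), \<chi> i. \<alpha> $ i / r $ i) \<bullet> (p, r) = 1 - G * norm p"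
      using r by (simp add: inner_vec_def[of _ r] \<alpha>_sum less_imp_neq[symmetric])
    finally have "(G * norm p)\<^sup>2 < 1"
      using G(1) by (simp add: abs_square_less_1 abs_mult)
    then have "(norm p)\<^sup>2 * power_prod \<alpha> \<alpha> / power_prod \<alpha> r < 1"
      by (simp add: power_mult_distrib G(2) mult.commute)
    then show ?thesis using power_prod_pos[of r \<alpha>] r by (simp add: divide_less_eq)
  qed
qed

section \<open>A certificate of optimality\<close>

text \<open>
  A certificate of optimality that replaces concavity of the barrier. The hypotheses say that
  the gradient of the objective vanishes at \<open>(- \<eta> p, W)\<close>. With \<open>w\<^sub>i = W\<^sub>i t\<^sub>i\<close>, the geometric mean
  of \<open>w\<close> is \<open>A T\<close>, where \<open>A\<close> and \<open>T\<close> are those of \<open>W\<close> and \<open>t\<close>, and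
  the first logarithm splits into \<open>ln (A T - v) + ln (A T + v)\<close> for \<open>v = \<parallel>u\<parallel>\<close>. Every
  logarithm is bounded by its tangent at the claimed maximizer, \<open>T\<close> by the arithmetic mean
  of the \<open>t\<^sub>i\<close>, and \<open>- p \<bullet> u\<close> by \<open>\<parallel>p\<parallel> v\<close>. All of these bounds are linear in
  \<open>v\<close> and \<open>t\<close>, and their sum is constant: the constant is the value at the maximizer.
\<close>

lemma rpower_barrier_max:
  fixes p :: "real ^ 'm" and r w W :: "real ^ 'n" and \<eta> :: real
  assumes \<eta>: "0 < \<eta>" and W: "\<And>i. 0 < W $ i"
    and prod_W: "power_prod \<alpha> W = \<eta> * (\<eta> * (norm p)\<^sup>2 + 2)"
    and r_W: "\<And>i. r $ i * W $ i = \<alpha> $ i * (1 + \<eta> * (norm p)\<^sup>2) + 1"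
    and uw: "\<And>i. 0 < w $ i" "norm u < weighted_gmean \<alpha> w"
  shows "- ((p, r) \<bullet> (u, w)) - rpower_barrier \<alpha> (u, w)
    \<le> - ((p, r) \<bullet> (- (\<eta> *\<^sub>R p), W)) - rpower_barrier \<alpha> (- (\<eta> *\<^sub>R p), W)"
proof -
  define P where "P = norm p"
  define v where "v = norm u"
  define A where "A = weighted_gmean \<alpha> W"
  define y where "y = \<eta> * P"
  define t where "t = (\<chi> i. w $ i / W $ i)"
  define T where "T = weighted_gmean \<alpha> t"
  have t: "0 < t $ i" for i using uw(1) W by (simp add: t_def)
  have w_eq: "w $ i = W $ i * t $ i" for i using W[of i] by (simp add: t_def)
  have A: "0 < A" unfolding A_def using W by (auto intro!: prod_pos simp: less_imp_neq[symmetric])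
  have A2: "A\<^sup>2 = y\<^sup>2 + 2 * \<eta>"
    unfolding A_def weighted_gmean_power2 prod_W
    by (simp add: y_def P_def power2_eq_square algebra_simps)
  have y: "0 \<le> y" "y < A"
    using \<eta> A2 A by (auto simp: y_def P_def intro!: power2_less_imp_less[of _ A])
  have gw: "weighted_gmean \<alpha> w = A * T"
    unfolding A_def T_def w_eq using W t by (simp add: powr_mult less_imp_le prod.distrib)
  have v: "0 \<le> v" "v < A * T" using uw(2) by (simp_all add: v_def gw)
  have sq: "(A - y) * (A + y) = 2 * \<eta>" using A2 by (simp add: power2_eq_square algebra_simps)
  \<comment> \<open>concavity of the logarithm: its graph lies below the tangent at \<open>b\<close>\<close>
  have tangent: "ln a \<le> ln b + a / b - 1" if "0 < a" "0 < b" for a b :: real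
    using ln_le_minus_one[of "a / b"] that by (simp add: ln_div)
  have "power_prod \<alpha> w - (norm u)\<^sup>2 = (A * T - v) * (A * T + v)"
    unfolding weighted_gmean_power2[symmetric] gw v_def[symmetric]
    by (simp add: power2_eq_square algebra_simps)
  then have "ln (power_prod \<alpha> w - (norm u)\<^sup>2) = ln (A * T - v) + ln (A * T + v)"
    using v by (simp add: ln_mult)
  also have "\<dots> \<le> (ln (A - y) + (A * T - v) / (A - y) - 1) + (ln (A + y) + (A * T + v) / (A + y) - 1)"
    using v y A by (intro add_mono tangent) auto
  also have "\<dots> = ln (2 * \<eta>) + ((A * T - v) / (A - y) + (A * T + v) / (A + y)) - 2"
    using ln_mult[of "A - y" "A + y"] y A by (simp add: sq)
  also have "(A * T - v) / (A - y) + (A * T + v) / (A + y)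
      = ((A * T - v) * (A + y) + (A * T + v) * (A - y)) / ((A - y) * (A + y))"
    using y A by (subst add_frac_eq) (auto simp: algebra_simps)
  also have "\<dots> = (A\<^sup>2 * T - v * y) / \<eta>"
    unfolding sq using \<eta> by (simp add: field_simps power2_eq_square)
  \<comment> \<open>the coefficient of \<open>v\<close> is now \<open>- P\<close>, so that \<open>v\<close> cancels against the bound \<open>v * P\<close> for \<open>- (p \<bullet> u)\<close>\<close>
  also have "\<dots> = (\<eta> * P\<^sup>2 + 2) * T - v * P"
    unfolding A2 using \<eta> by (simp add: y_def field_simps power2_eq_square)
  also have "(\<eta> * P\<^sup>2 + 2) * T \<le> (\<eta> * P\<^sup>2 + 2) * (\<Sum>i\<in>UNIV. \<alpha> $ i * t $ i)"
    unfolding T_def using \<eta> weighted_am_gm[OF t] by (intro mult_left_mono) auto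
  finally have ln_bound: "ln (power_prod \<alpha> w - (norm u)\<^sup>2)
      \<le> ln (2 * \<eta>) + (\<eta> * P\<^sup>2 + 2) * (\<Sum>i\<in>UNIV. \<alpha> $ i * t $ i) - v * P - 2"
    by simp
  have "(\<Sum>i\<in>UNIV. (1 - \<alpha> $ i) * ln (w $ i))
      \<le> (\<Sum>i\<in>UNIV. (1 - \<alpha> $ i) * (ln (W $ i) + t $ i - 1))"
    using tangent[OF uw(1) W] by (intro sum_mono mult_left_mono) (auto simp: t_def weight_le_1)
  moreover have "- (p \<bullet> u) \<le> v * P"
    using Cauchy_Schwarz_ineq2[of p u] by (simp add: v_def P_def mult.commute)
  moreover have "r \<bullet> w = (1 + \<eta> * P\<^sup>2) * (\<Sum>i\<in>UNIV. \<alpha> $ i * t $ i) + (\<Sum>i\<in>UNIV. t $ i)"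
  proof -
    have "r \<bullet> w = (\<Sum>i\<in>UNIV. (\<alpha> $ i * (1 + \<eta> * P\<^sup>2) + 1) * t $ i)"
      unfolding inner_vec_def w_eq using r_W by (simp add: P_def flip: mult.assoc)
    also have "\<dots> = (\<Sum>i\<in>UNIV. (1 + \<eta> * P\<^sup>2) * (\<alpha> $ i * t $ i) + t $ i)"
      by (intro sum.cong refl) (simp add: algebra_simps)
    finally show ?thesis by (simp add: sum.distrib sum_distrib_left)
  qed
  moreover have "r \<bullet> W = 1 + \<eta> * P\<^sup>2 + real CARD('n)"
  proof -
    have "r \<bullet> W = (\<Sum>i\<in>UNIV. (\<alpha> $ i * (1 + \<eta> * P\<^sup>2) + 1))"
      unfolding inner_vec_def using r_W by (simp add: P_def)
    then show ?thesis by (simp add: sum.distrib \<alpha>_sum flip: sum_distrib_right)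
  qed
  moreover have "power_prod \<alpha> W - (norm (- (\<eta> *\<^sub>R p)))\<^sup>2 = 2 * \<eta>"
    using prod_W by (simp add: power_mult_distrib power2_eq_square algebra_simps)
  moreover have "(\<Sum>i\<in>UNIV. (1 - \<alpha> $ i) * (ln (W $ i) + t $ i - 1))
      = (\<Sum>i\<in>UNIV. (1 - \<alpha> $ i) * ln (W $ i)) + (\<Sum>i\<in>UNIV. t $ i)
        - (\<Sum>i\<in>UNIV. \<alpha> $ i * t $ i) - real CARD('n) + 1"
    by (simp add: algebra_simps sum.distrib sum_subtractf \<alpha>_sum)
  moreover have "p \<bullet> p = P\<^sup>2"
    by (simp add: P_def power2_norm_eq_inner)
  ultimately show ?thesis
    using ln_bound by (simp add: rpower_barrier_def distrib_right)
qed

end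

section \<open>The root equation\<close>

text \<open>
  The numerator of the negated \<open>r\<^sub>i\<close>-component of the conjugate gradient, as a function of
  \<open>x = \<parallel>p\<parallel> yhat\<close>.
\<close>

definition gradient_numer :: "real ^ 'n \<Rightarrow> real \<Rightarrow> real ^ 'n" where
  "gradient_numer \<alpha> x = (\<chi> i. \<alpha> $ i * (1 + x) + 1)"

text \<open>
  The equation \<open>h y = 0\<close> is \<open>root_ratio \<alpha> (\<parallel>p\<parallel> y) = \<parallel>p\<parallel>\<^sup>2 / \<phi>\<close>. In this form it also makes sense at
  \<open>p = 0\<close>, where its solution is \<open>0\<close>, and \<open>(p, r)\<close> enters only through the value to be attained.
\<close>

definition root_ratio :: "real ^ 'n \<Rightarrow> real \<Rightarrow> real" where
  "root_ratio \<alpha> x = x * (x + 2) / power_prod \<alpha> (gradient_numer \<alpha> x)"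

definition inv_root_ratio :: "real ^ 'n \<Rightarrow> real \<Rightarrow> real" where
  "inv_root_ratio \<alpha> q = (THE x. 0 \<le> x \<and> root_ratio \<alpha> x = q)"

text \<open>
  This is \<open>\<parallel>p\<parallel> yhat\<close>, with the value \<open>0\<close> for \<open>p = 0\<close>.
\<close>

definition norm_times_root :: "real ^ 'n \<Rightarrow> real ^ 'm \<Rightarrow> real ^ 'n \<Rightarrow> real" where
  "norm_times_root \<alpha> p r = inv_root_ratio \<alpha> ((norm p)\<^sup>2 / power_prod \<alpha> r)"

text \<open>
  This is \<open>yhat / \<parallel>p\<parallel>\<close>, written without a division by \<open>\<parallel>p\<parallel>\<close> so that it extends continuously,
  with a positive value, to \<open>p = 0\<close>.
\<close>

definition rpower_slope :: "real ^ 'n \<Rightarrow> real ^ 'm \<Rightarrow> real ^ 'n \<Rightarrow> real" where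
  "rpower_slope \<alpha> p r = power_prod \<alpha> (gradient_numer \<alpha> (norm_times_root \<alpha> p r))
      / (power_prod \<alpha> r * (norm_times_root \<alpha> p r + 2))"

definition rpower_argmax ::
    "real ^ 'n \<Rightarrow> (real ^ 'm) \<times> (real ^ 'n) \<Rightarrow> (real ^ 'm) \<times> (real ^ 'n)" where
  "rpower_argmax \<alpha> = (\<lambda>(p, r). (- (rpower_slope \<alpha> p r *\<^sub>R p),
      \<chi> i. gradient_numer \<alpha> (norm_times_root \<alpha> p r) $ i / r $ i))"

context
  fixes \<alpha> :: "real ^ 'n"
  assumes \<alpha>_pos: "\<And>i. 0 < \<alpha> $ i" and \<alpha>_sum: "(\<Sum>i\<in>UNIV. \<alpha> $ i) = 1"
begin

lemma gradient_numer_pos: "0 \<le> x \<Longrightarrow> 0 < gradient_numer \<alpha> x $ i"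
  using \<alpha>_pos[of i] by (simp add: gradient_numer_def add_pos_pos)

lemma power_prod_gradient_numer_pos: "0 \<le> x \<Longrightarrow> 0 < power_prod \<alpha> (gradient_numer \<alpha> x)"
  by (intro power_prod_pos gradient_numer_pos)

text \<open>
  As no weight exceeds one, each factor satisfies
  \<open>(\<alpha>\<^sub>i (1 + x') + 1) / (\<alpha>\<^sub>i (1 + x) + 1) \<le> (x' + 2) / (x + 2)\<close>; the exponents \<open>2 \<alpha>\<^sub>i\<close> sum to two.
\<close>

lemma power_prod_gradient_numer_growth:
  assumes "0 \<le> x" "x \<le> x'"
  shows "power_prod \<alpha> (gradient_numer \<alpha> x') \<le> ((x' + 2) / (x + 2))\<^sup>2 * power_prod \<alpha> (gradient_numer \<alpha> x)"
proof -
  let ?k = "(x' + 2) / (x + 2)"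
  have le: "gradient_numer \<alpha> x' $ i \<le> ?k * gradient_numer \<alpha> x $ i" for i
  proof -
    have "0 \<le> (x' - x) * (1 - \<alpha> $ i)"
      using assms weight_le_1[OF \<alpha>_pos \<alpha>_sum] by simp
    then have "(x + 2) * gradient_numer \<alpha> x' $ i \<le> (x' + 2) * gradient_numer \<alpha> x $ i"
      by (simp add: gradient_numer_def algebra_simps)
    then show ?thesis using assms by (simp add: field_simps)
  qed
  have "power_prod \<alpha> (gradient_numer \<alpha> x') \<le> power_prod \<alpha> (\<chi> i. ?k * gradient_numer \<alpha> x $ i)"
    unfolding power_prod_def using assms le gradient_numer_pos[of x'] \<alpha>_pos
    by (intro prod_mono conjI powr_mono2) (auto simp: less_imp_le)
  also have "\<dots> = ?k\<^sup>2 * power_prod \<alpha> (gradient_numer \<alpha> x)"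
    using assms gradient_numer_pos by (intro power_prod_scale \<alpha>_pos \<alpha>_sum) auto
  finally show ?thesis .
qed

text \<open>
  The growth bound for the denominator reduces the claim to
  \<open>x / (x + 2) < x' / (x' + 2)\<close>. This is the uniqueness of the root.
\<close>

lemma strict_mono_on_root_ratio: "strict_mono_on {0..} (root_ratio \<alpha>)"
proof (rule strict_mono_onI)
  fix x x' :: real assume x: "x \<in> {0..}" and less: "x < x'"
  let ?p = "power_prod \<alpha> (gradient_numer \<alpha> x)" and ?p' = "power_prod \<alpha> (gradient_numer \<alpha> x')"
  have pos: "0 < ?p" "0 < ?p'" using x less power_prod_gradient_numer_pos by auto
  have "x * (x + 2) * ?p' \<le> x * (x + 2) * (((x' + 2) / (x + 2))\<^sup>2 * ?p)"
    using x less power_prod_gradient_numer_growth[of x x'] by (intro mult_left_mono) auto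
  also have "\<dots> = (x' + 2) * ?p * (x * (x' + 2) / (x + 2))"
  proof -
    have "x * a * ((b / a)\<^sup>2 * c) = b * c * (x * b / a)" if "a \<noteq> 0" for a b c :: real
      using that by (simp add: field_simps power2_eq_square)
    then show ?thesis using x by simp
  qed
  also have "\<dots> < (x' + 2) * ?p * x'"
    using x less pos by (intro mult_strict_left_mono mult_pos_pos) (auto simp: field_simps)
  finally have "x * (x + 2) * ?p' < x' * (x' + 2) * ?p" by (simp add: algebra_simps)
  then show "root_ratio \<alpha> x < root_ratio \<alpha> x'"
    unfolding root_ratio_def using pos by (simp add: field_simps)
qed

lemma continuous_on_root_ratio: "continuous_on {0..} (root_ratio \<alpha>)"
proof -
  have "continuous_on {0..} (gradient_numer \<alpha>)"
    unfolding gradient_numer_def by (intro continuous_intros)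
  then show ?thesis
    unfolding root_ratio_def using power_prod_gradient_numer_pos gradient_numer_pos
    by (intro continuous_intros continuous_on_power_prod) (auto simp: less_imp_neq[symmetric])
qed

text \<open>
  At infinity \<open>root_ratio \<alpha>\<close> tends to \<open>1 / power_prod \<alpha> \<alpha>\<close>: by homogeneity of degree two, its
  value at \<open>1 / e\<close> is a function of \<open>e\<close> that is continuous up to \<open>e = 0\<close>. Together with the
  intermediate value theorem this gives the existence of the root, precisely under the
  inequality that describes the interior of the dual cone.
\<close>

lemma root_ratio_exceeds:
  assumes "q * power_prod \<alpha> \<alpha> < 1"
  obtains x where "0 < x" "q < root_ratio \<alpha> x"
proof -
  let ?v = "\<lambda>e. \<chi> i. \<alpha> $ i * (e + 1) + e"
  let ?N = "\<lambda>e. (1 + 2 * e) / power_prod \<alpha> (?v e)"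
  have pos: "0 < power_prod \<alpha> \<alpha>" using \<alpha>_pos by (intro power_prod_pos)
  have "isCont (\<lambda>e. power_prod \<alpha> (?v e)) 0"
    unfolding power_prod_def using \<alpha>_pos
    by (auto intro!: continuous_intros simp: less_imp_neq[symmetric])
  then have "isCont ?N 0"
    using pos by (intro continuous_intros) auto
  then have "(?N \<longlongrightarrow> ?N 0) (at_right 0)"
    unfolding isCont_def by (rule tendsto_within_subset) simp
  moreover have "q < ?N 0" using assms pos by (simp add: field_simps)
  ultimately have "\<forall>\<^sub>F e in at_right 0. q < ?N e" by (rule order_tendstoD)
  then have "\<forall>\<^sub>F e in at_right 0. q < ?N e \<and> 0 < e"
    using eventually_at_right_less by (rule eventually_conj)
  then obtain e where e: "q < ?N e" "0 < e"
    using eventually_happens[of _ "at_right (0::real)"] trivial_limit_at_right_real by blast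
  have "gradient_numer \<alpha> (1 / e) = (\<chi> i. (1 / e) * ?v e $ i)"
    using e(2) by (simp add: gradient_numer_def vec_eq_iff field_simps)
  also have "power_prod \<alpha> \<dots> = (1 / e)\<^sup>2 * power_prod \<alpha> (?v e)"
    using e(2) \<alpha>_pos by (intro power_prod_scale \<alpha>_pos \<alpha>_sum) (auto intro: add_pos_pos)
  finally have "root_ratio \<alpha> (1 / e) = ?N e"
    using e(2) by (simp add: root_ratio_def field_simps power2_eq_square)
  then show ?thesis using e that[of "1 / e"] by simp
qed

lemma inv_root_ratio:
  assumes "0 \<le> q" "q * power_prod \<alpha> \<alpha> < 1"
  shows "0 \<le> inv_root_ratio \<alpha> q" "root_ratio \<alpha> (inv_root_ratio \<alpha> q) = q"
proof -
  obtain b where b: "0 < b" "q < root_ratio \<alpha> b" using assms(2) by (rule root_ratio_exceeds)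
  have "\<exists>x\<ge>0. x \<le> b \<and> root_ratio \<alpha> x = q"
  proof (rule IVT')
    show "root_ratio \<alpha> 0 \<le> q" using assms(1) by (simp add: root_ratio_def)
    show "continuous_on {0..b} (root_ratio \<alpha>)"
      by (rule continuous_on_subset[OF continuous_on_root_ratio]) auto
  qed (use b in auto)
  then have "\<exists>!x. 0 \<le> x \<and> root_ratio \<alpha> x = q"
    using strict_mono_on_imp_inj_on[OF strict_mono_on_root_ratio]
    by (auto simp: inj_on_def)
  from theI'[OF this] show "0 \<le> inv_root_ratio \<alpha> q" "root_ratio \<alpha> (inv_root_ratio \<alpha> q) = q"
    by (simp_all add: inv_root_ratio_def)
qed

lemma inv_root_ratio_eqI:
  assumes "0 \<le> x"
  shows "inv_root_ratio \<alpha> (root_ratio \<alpha> x) = x"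
  unfolding inv_root_ratio_def using assms strict_mono_on_imp_inj_on[OF strict_mono_on_root_ratio]
  by (intro the_equality) (auto simp: inj_on_def)

text \<open>
  The inverse of a strictly increasing function is continuous: a bound on the inverse at \<open>q\<close> is
  the same as a bound on \<open>q\<close>. The end point \<open>q = 0\<close> belongs to the domain because it
  corresponds to \<open>p = 0\<close>.
\<close>

lemma continuous_on_inv_root_ratio:
  "continuous_on {q. 0 \<le> q \<and> q * power_prod \<alpha> \<alpha> < 1} (inv_root_ratio \<alpha>)" (is "continuous_on ?Q _")
  unfolding continuous_on_def
proof (intro ballI order_tendstoI)
  have less_iff: "root_ratio \<alpha> x < root_ratio \<alpha> x' \<longleftrightarrow> x < x'" if "0 \<le> x" "0 \<le> x'" for x x'
    using strict_mono_on_less[OF strict_mono_on_root_ratio] that by simp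
  fix q a assume q: "q \<in> ?Q"
  let ?X = "inv_root_ratio \<alpha>"
  have X: "0 \<le> ?X q'" "root_ratio \<alpha> (?X q') = q'" if "q' \<in> ?Q" for q'
    using inv_root_ratio that by auto
  have ev: "\<forall>\<^sub>F q' in at q within ?Q. q' \<in> ?Q" by (simp add: eventually_at_filter)
  have lim: "((\<lambda>q'. q') \<longlongrightarrow> q) (at q within ?Q)" by (rule tendsto_ident_at)
  show "\<forall>\<^sub>F q' in at q within ?Q. a < ?X q'" if a: "a < ?X q"
  proof (cases "a < 0")
    case True
    show ?thesis by (rule eventually_mono[OF ev]) (use True X in fastforce)
  next
    case False
    then have "root_ratio \<alpha> a < q" using a X[OF q] less_iff[of a "?X q"] by simp
    from order_tendstoD(1)[OF lim this] ev show ?thesis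
    proof eventually_elim
      case (elim q') then show ?case using False X[of q'] less_iff[of a "?X q'"] by simp
    qed
  qed
  show "\<forall>\<^sub>F q' in at q within ?Q. ?X q' < a" if a: "?X q < a"
  proof -
    have "0 \<le> a" "q < root_ratio \<alpha> a" using a X[OF q] less_iff[of "?X q" a] by auto
    from order_tendstoD(2)[OF lim this(2)] ev show ?thesis
    proof eventually_elim
      case (elim q') then show ?case using \<open>0 \<le> a\<close> X[of q'] less_iff[of "?X q'" a] by simp
    qed
  qed
qed

text \<open>
  The argument of the logarithm in the sum is
  \<open>(2 y / \<parallel>p\<parallel>) (\<alpha>\<^sub>i (1 + \<parallel>p\<parallel> y) + 1)\<close>. As the weights sum to one, the first factors contribute
  \<open>2 ln (2 y / \<parallel>p\<parallel>)\<close>, which the last term of \<open>h\<close> cancels.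
\<close>

lemma rpower_h_eq_0_iff:
  assumes r: "\<And>i. 0 < r $ i" and p: "p \<noteq> 0" and y: "0 < y"
  shows "rpower_h \<alpha> p r y = 0 \<longleftrightarrow> root_ratio \<alpha> (norm p * y) = (norm p)\<^sup>2 / power_prod \<alpha> r"
proof -
  define P where "P = norm p"
  define k where "k = 2 * y / P"
  define v where "v = gradient_numer \<alpha> (P * y)"
  have P: "0 < P" and k: "0 < k" using p y by (simp_all add: P_def k_def)
  have v: "0 < v $ i" for i using P y by (simp add: v_def gradient_numer_pos)
  have pos: "0 < power_prod \<alpha> r" "0 < power_prod \<alpha> v" using r v by (auto intro: power_prod_pos)
  have ky: "0 < k + y\<^sup>2" using k by (simp add: add_pos_nonneg)
  have factor: "2 * \<alpha> $ i * y\<^sup>2 + 2 * y * (1 + \<alpha> $ i) / P = k * v $ i" for i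
    using P by (simp add: k_def v_def gradient_numer_def field_simps power2_eq_square)
  have "(\<Sum>i\<in>UNIV. 2 * \<alpha> $ i * ln (2 * \<alpha> $ i * y\<^sup>2 + 2 * y * (1 + \<alpha> $ i) / P))
      = ln (power_prod \<alpha> (\<chi> i. k * v $ i))"
    using k v by (subst ln_power_prod) (simp_all add: factor)
  also have "\<dots> = 2 * ln k + ln (power_prod \<alpha> v)"
    using k v pos by (simp add: power_prod_scale[OF \<alpha>_pos \<alpha>_sum] ln_mult ln_realpow)
  finally have "rpower_h \<alpha> p r y = ln (power_prod \<alpha> v) - (ln (power_prod \<alpha> r) + ln (k + y\<^sup>2))"
    by (simp add: rpower_h_def P_def[symmetric] k_def[symmetric])
  also have "\<dots> = ln (power_prod \<alpha> v) - ln (power_prod \<alpha> r * (k + y\<^sup>2))"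
    using pos ky by (simp add: ln_mult)
  finally have "rpower_h \<alpha> p r y = 0 \<longleftrightarrow> power_prod \<alpha> v = power_prod \<alpha> r * (k + y\<^sup>2)"
    using pos ky by simp
  also have "k + y\<^sup>2 = P * y * (P * y + 2) / P\<^sup>2"
    using P by (simp add: k_def field_simps power2_eq_square)
  finally show ?thesis
    using pos P unfolding root_ratio_def P_def[symmetric] v_def[symmetric]
    by (auto simp: field_simps)
qed

lemma rpower_root:
  assumes r: "\<And>i. 0 < r $ i" and dual: "(norm p)\<^sup>2 * power_prod \<alpha> \<alpha> < power_prod \<alpha> r"
    and p: "p \<noteq> 0"
  shows "\<exists>!y. 0 < y \<and> rpower_h \<alpha> p r y = 0"
    and "norm p * rpower_root \<alpha> p r = inv_root_ratio \<alpha> ((norm p)\<^sup>2 / power_prod \<alpha> r)"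
proof -
  define q where "q = (norm p)\<^sup>2 / power_prod \<alpha> r"
  let ?X = "inv_root_ratio \<alpha> q"
  have \<phi>: "0 < power_prod \<alpha> r" using r by (rule power_prod_pos)
  have q: "0 < q" "q * power_prod \<alpha> \<alpha> < 1" using \<phi> dual p by (simp_all add: q_def)
  have X: "0 \<le> ?X" "root_ratio \<alpha> ?X = q" using inv_root_ratio[of q] q by auto
  have "?X \<noteq> 0" using X(2) q(1) by (auto simp: root_ratio_def)
  with X have X_pos: "0 < ?X" by simp
  have iff: "0 < y \<and> rpower_h \<alpha> p r y = 0 \<longleftrightarrow> y = ?X / norm p" for y
  proof
    assume y: "0 < y \<and> rpower_h \<alpha> p r y = 0"
    then have "root_ratio \<alpha> (norm p * y) = q"
      using rpower_h_eq_0_iff[OF r p, of y] by (simp add: q_def)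
    then have "?X = norm p * y" using y inv_root_ratio_eqI[of "norm p * y"] by simp
    then show "y = ?X / norm p" using p by simp
  next
    assume "y = ?X / norm p"
    then show "0 < y \<and> rpower_h \<alpha> p r y = 0"
      using X_pos X(2) p rpower_h_eq_0_iff[OF r p, of y] by (simp add: q_def)
  qed
  show "\<exists>!y. 0 < y \<and> rpower_h \<alpha> p r y = 0" unfolding iff by simp
  show "norm p * rpower_root \<alpha> p r = inv_root_ratio \<alpha> ((norm p)\<^sup>2 / power_prod \<alpha> r)"
    unfolding rpower_root_def iff q_def[symmetric] using p by simp
qed

section \<open>The maximizers\<close>

text \<open>
  The root equation, rearranged into the stationarity conditions that \<open>rpower_barrier_max\<close> asks
  for, with \<open>p = 0\<close> included.
\<close>

lemma rpower_slope:
  fixes p :: "real ^ 'm"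
  assumes r: "\<And>i. 0 < r $ i" and dual: "(norm p)\<^sup>2 * power_prod \<alpha> \<alpha> < power_prod \<alpha> r"
  shows "0 \<le> norm_times_root \<alpha> p r" "0 < rpower_slope \<alpha> p r"
    "rpower_slope \<alpha> p r * (norm p)\<^sup>2 = norm_times_root \<alpha> p r"
    "power_prod \<alpha> (snd (rpower_argmax \<alpha> (p, r))) = rpower_slope \<alpha> p r * (norm_times_root \<alpha> p r + 2)"
proof -
  let ?x = "norm_times_root \<alpha> p r"
  have \<phi>: "0 < power_prod \<alpha> r" using r by (rule power_prod_pos)
  have x: "0 \<le> ?x" "root_ratio \<alpha> ?x = (norm p)\<^sup>2 / power_prod \<alpha> r"
    unfolding norm_times_root_def using \<phi> dual by (auto intro!: inv_root_ratio)
  then show "0 \<le> ?x" by simp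
  have pp: "0 < power_prod \<alpha> (gradient_numer \<alpha> ?x)" using x by (rule_tac power_prod_gradient_numer_pos)
  show "0 < rpower_slope \<alpha> p r" using \<phi> pp x by (simp add: rpower_slope_def)
  have "?x * (?x + 2) * power_prod \<alpha> r = (norm p)\<^sup>2 * power_prod \<alpha> (gradient_numer \<alpha> ?x)"
    using x(2) \<phi> pp by (simp add: root_ratio_def frac_eq_eq)
  then show "rpower_slope \<alpha> p r * (norm p)\<^sup>2 = ?x"
    using \<phi> x(1) by (simp add: rpower_slope_def divide_eq_eq mult_ac)
  show "power_prod \<alpha> (snd (rpower_argmax \<alpha> (p, r))) = rpower_slope \<alpha> p r * (?x + 2)"
    using x(1) \<phi> r gradient_numer_pos[OF x(1)]
    by (simp add: rpower_argmax_def rpower_slope_def power_prod_divide)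
qed

lemma continuous_on_rpower_argmax:
  "continuous_on {(p :: real ^ 'm, r). (\<forall>i. 0 < r $ i) \<and>
     (norm p)\<^sup>2 * power_prod \<alpha> \<alpha> < power_prod \<alpha> r} (rpower_argmax \<alpha>)"
  (is "continuous_on ?S _")
proof -
  have pos: "0 < snd s $ i" "0 < power_prod \<alpha> (snd s)" "0 \<le> norm_times_root \<alpha> (fst s) (snd s)"
    "(norm (fst s))\<^sup>2 * power_prod \<alpha> \<alpha> < power_prod \<alpha> (snd s)" if "s \<in> ?S" for s i
    using that by (auto intro: power_prod_pos rpower_slope(1))
  have \<phi>: "continuous_on ?S (\<lambda>s. power_prod \<alpha> (snd s))"
    by (intro continuous_on_power_prod continuous_intros pos(1))
  have x: "continuous_on ?S (\<lambda>s. norm_times_root \<alpha> (fst s) (snd s))"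
    unfolding norm_times_root_def
  proof (rule continuous_on_compose2[OF continuous_on_inv_root_ratio])
    show "continuous_on ?S (\<lambda>s. (norm (fst s))\<^sup>2 / power_prod \<alpha> (snd s))"
      using pos(2) by (intro continuous_intros \<phi>) fastforce
  qed (use pos(2,4) in \<open>auto simp: less_imp_le\<close>)
  have scaling: "continuous_on ?S (\<lambda>s. gradient_numer \<alpha> (norm_times_root \<alpha> (fst s) (snd s)))"
    unfolding gradient_numer_def by (intro continuous_intros x)
  then have "continuous_on ?S (\<lambda>s. power_prod \<alpha> (gradient_numer \<alpha> (norm_times_root \<alpha> (fst s) (snd s))))"
    by (rule continuous_on_power_prod) (rule gradient_numer_pos[OF pos(3)])
  moreover have "power_prod \<alpha> (snd s) * (norm_times_root \<alpha> (fst s) (snd s) + 2) \<noteq> 0" if "s \<in> ?S" for s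
    using pos(2,3)[OF that] by simp
  ultimately have "continuous_on ?S (\<lambda>s. rpower_slope \<alpha> (fst s) (snd s))"
    unfolding rpower_slope_def by (intro continuous_intros \<phi> x) auto
  note slope = this
  have argmax: "rpower_argmax \<alpha> = (\<lambda>s. (- (rpower_slope \<alpha> (fst s) (snd s) *\<^sub>R fst s),
      \<chi> i. gradient_numer \<alpha> (norm_times_root \<alpha> (fst s) (snd s)) $ i / snd s $ i))"
    by (simp add: rpower_argmax_def fun_eq_iff)
  show ?thesis
    unfolding argmax using pos(1)
    by (intro continuous_intros slope scaling) (auto simp: less_imp_neq[symmetric])
qed

lemma conjugate_gradient_rpower:
  fixes p :: "real ^ 'm"
  defines "K \<equiv> rpower_cone \<alpha> :: ((real ^ 'm) \<times> (real ^ 'n)) set"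
  assumes pr: "(p, r) \<in> interior (dual_cone K)"
  shows "GDERIV (conjugate_barrier K (rpower_barrier \<alpha>)) (p, r) :> - rpower_argmax \<alpha> (p, r)"
proof (rule GDERIV_conjugate_barrier)
  show "open (interior (dual_cone K))" "(p, r) \<in> interior (dual_cone K)" using pr by auto
  note dual = interior_dual_rpower_cone_subset[OF \<alpha>_pos \<alpha>_sum, where 'm = 'm, folded K_def]
  show "isCont (rpower_argmax \<alpha>) (p, r)"
  proof -
    have "continuous_on (interior (dual_cone K)) (rpower_argmax \<alpha>)"
      by (rule continuous_on_subset[OF continuous_on_rpower_argmax]) (use dual in auto)
    then show ?thesis using pr by (simp add: continuous_on_eq_continuous_at)
  qed
  fix t assume t: "t \<in> interior (dual_cone K)"
  obtain p' r' where t_eq: "t = (p', r')" by force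
  note d = dual[OF t[unfolded t_eq]]
  define \<eta> where "\<eta> = rpower_slope \<alpha> p' r'"
  define W where "W = snd (rpower_argmax \<alpha> (p', r'))"
  note slope = rpower_slope[OF d, folded \<eta>_def W_def]
  have arg: "rpower_argmax \<alpha> t = (- (\<eta> *\<^sub>R p'), W)"
    by (simp add: t_eq \<eta>_def W_def rpower_argmax_def)
  have W_nth: "W $ i = (\<alpha> $ i * (1 + \<eta> * (norm p')\<^sup>2) + 1) / r' $ i" for i
    unfolding slope(3) by (simp add: W_def rpower_argmax_def gradient_numer_def)
  have W: "0 < W $ i" for i
    using gradient_numer_pos[OF slope(1), of i] d(1)[of i] by (simp add: W_def rpower_argmax_def)
  have prod_W: "power_prod \<alpha> W = \<eta> * (\<eta> * (norm p')\<^sup>2 + 2)" using slope(3,4) by simp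
  have "(norm (\<eta> *\<^sub>R p'))\<^sup>2 < (weighted_gmean \<alpha> W)\<^sup>2"
    unfolding weighted_gmean_power2 prod_W using slope(2)
    by (simp add: power_mult_distrib power2_eq_square algebra_simps)
  then have "norm (\<eta> *\<^sub>R p') < weighted_gmean \<alpha> W"
    by (rule power2_less_imp_less) (auto intro: prod_nonneg)
  then show "rpower_argmax \<alpha> t \<in> interior K"
    unfolding K_def interior_rpower_cone[OF \<alpha>_pos \<alpha>_sum] arg using W by simp
  fix w assume w: "w \<in> interior K"
  obtain u v where w_eq: "w = (u, v)" by force
  have uv: "0 < v $ i" "norm u < weighted_gmean \<alpha> v" for i
    using w unfolding K_def interior_rpower_cone[OF \<alpha>_pos \<alpha>_sum] w_eq by auto
  show "- (t \<bullet> w) - rpower_barrier \<alpha> w \<le> - (t \<bullet> rpower_argmax \<alpha> t) - rpower_barrier \<alpha> (rpower_argmax \<alpha> t)"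
    unfolding arg unfolding t_eq w_eq
  proof (rule rpower_barrier_max[OF \<alpha>_pos \<alpha>_sum slope(2) W prod_W _ uv])
    show "r' $ i * W $ i = \<alpha> $ i * (1 + \<eta> * (norm p')\<^sup>2) + 1" for i
      using d(1)[of i] by (simp add: W_nth)
  qed
qed

end

section \<open>Equal weights: the radial geometric mean cone\<close>

text \<open>
  With equal weights \<open>1 / d\<close>, the root equation is this quadratic equation in \<open>z = 1 + \<parallel>p\<parallel> yhat\<close>.
  Its roots have opposite signs, so the positive one carries the positive square root.
\<close>

lemma rgeom_quadratic_root:
  fixes d \<phi> p z :: real
  assumes d: "0 < d" and z: "0 < z" and disc: "p\<^sup>2 < \<phi> * d\<^sup>2"
    and eq: "p\<^sup>2 * (d + z)\<^sup>2 = d\<^sup>2 * \<phi> * (z\<^sup>2 - 1)"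
  shows "z = d * ((p\<^sup>2 + sqrt (\<phi> * (d\<^sup>2 * \<phi> + d\<^sup>2 * p\<^sup>2 - p\<^sup>2))) / (\<phi> * d\<^sup>2 - p\<^sup>2))"
proof -
  define D where "D = \<phi> * d\<^sup>2 - p\<^sup>2"
  define S where "S = \<phi> * (d\<^sup>2 * \<phi> + d\<^sup>2 * p\<^sup>2 - p\<^sup>2)"
  have D: "0 < D" using disc by (simp add: D_def)
  have \<phi>: "0 < \<phi>"
    using disc d by (smt (verit) zero_le_power2 mult_nonpos_nonneg)
  have quad: "D * z\<^sup>2 = 2 * d * p\<^sup>2 * z + d\<^sup>2 * (p\<^sup>2 + \<phi>)"
    using eq by (simp add: D_def power2_eq_square algebra_simps)
  have "0 < d\<^sup>2 * (p\<^sup>2 + \<phi>)" using d \<phi> by (simp add: add_nonneg_pos)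
  moreover have "0 \<le> d * p\<^sup>2 * z" using d z by simp
  moreover have "z * (D * z - d * p\<^sup>2) = d * p\<^sup>2 * z + d\<^sup>2 * (p\<^sup>2 + \<phi>)"
    using quad by (simp add: power2_eq_square algebra_simps)
  ultimately have "0 < z * (D * z - d * p\<^sup>2)" by linarith
  then have nonneg: "0 \<le> D * z - d * p\<^sup>2" using z by (simp add: zero_less_mult_iff)
  have "(D * z - d * p\<^sup>2)\<^sup>2 = D * (D * z\<^sup>2) - D * (2 * d * p\<^sup>2 * z) + d\<^sup>2 * p\<^sup>2 * p\<^sup>2"
    by (simp add: power2_eq_square algebra_simps)
  also have "\<dots> = d\<^sup>2 * S"
    unfolding quad by (simp add: D_def S_def power2_eq_square algebra_simps)
  finally have "D * z - d * p\<^sup>2 = sqrt (d\<^sup>2 * S)"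
    using nonneg by (metis real_sqrt_unique)
  then have "D * z = d * (p\<^sup>2 + sqrt S)"
    using d by (simp add: real_sqrt_mult algebra_simps)
  then show ?thesis
    using D unfolding D_def[symmetric] S_def[symmetric] by (simp add: field_simps)
qed

theorem proposition3p5:
  fixes \<alpha> :: "real ^ 'd2" and p :: "real ^ 'd1" and r :: "real ^ 'd2"
  defines "K \<equiv> (rpower_cone \<alpha> :: ((real ^ 'd1) \<times> (real ^ 'd2)) set)"
    and "f \<equiv> (rpower_barrier \<alpha> :: (real ^ 'd1) \<times> (real ^ 'd2) \<Rightarrow> real)"
  defines "g \<equiv> conjugate_gradient K f (p, r)"
    and "yhat \<equiv> rpower_root \<alpha> p r"
    and "\<phi> \<equiv> power_prod \<alpha> r"
    and "d \<equiv> real CARD('d2)"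
  assumes "\<forall>i. \<alpha> $ i > 0"
    and "(\<Sum>i\<in>UNIV. \<alpha> $ i) = 1"
    and "(p, r) \<in> interior (dual_cone K)"
  shows "GDERIV (conjugate_barrier K f) (p, r) :> g \<and>
    (p \<noteq> 0 \<longrightarrow> (\<exists>!y. y > 0 \<and> rpower_h \<alpha> p r y = 0)) \<and>
    (\<forall>i. fst g $ i = of_bool (p \<noteq> 0) * yhat * (p $ i / norm p)) \<and>
    (\<forall>i. snd g $ i = - ((\<alpha> $ i * (1 + norm p * yhat) + 1) / r $ i)) \<and>
    (CARD('d1) = 1 \<and> (\<forall>i. \<alpha> $ i = 1 / d) \<longrightarrow>
      (\<forall>j. (p $ j > 0 \<longrightarrow> fst g $ j = rgeom_y_minus d \<phi> (p $ j)) \<and>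
           (p $ j = 0 \<longrightarrow> fst g $ j = 0) \<and>
           (p $ j < 0 \<longrightarrow> fst g $ j = - rgeom_y_minus d \<phi> (- (p $ j))) \<and>
           (\<forall>i. snd g $ i = - inverse (r $ i) *
              (((p $ j)\<^sup>2 + sqrt (\<phi> * (d\<^sup>2 * \<phi> + d\<^sup>2 * (p $ j)\<^sup>2 - (p $ j)\<^sup>2)))
                 / (\<phi> * d\<^sup>2 - (p $ j)\<^sup>2) + 1))))"
proof -
  have \<alpha>: "0 < \<alpha> $ i" for i using assms(7) by simp
  note sum1 = assms(8)
  note r = interior_dual_rpower_cone_subset(1)[OF \<alpha> sum1 assms(9)[unfolded K_def]]
  note dual = interior_dual_rpower_cone_subset(2)[OF \<alpha> sum1 assms(9)[unfolded K_def]]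
  let ?x = "norm_times_root \<alpha> p r" and ?\<eta> = "rpower_slope \<alpha> p r"
  note slope = rpower_slope[OF \<alpha> sum1 r dual]
  have \<phi>: "0 < \<phi>" unfolding \<phi>_def using r by (rule power_prod_pos)
  have grad: "GDERIV (conjugate_barrier K f) (p, r) :> - rpower_argmax \<alpha> (p, r)"
    unfolding K_def f_def
    by (rule conjugate_gradient_rpower[OF \<alpha> sum1 assms(9)[unfolded K_def]])
  then have g: "g = - rpower_argmax \<alpha> (p, r)"
    unfolding g_def by (rule conjugate_gradient_eqI)
  have fst_g: "fst g = ?\<eta> *\<^sub>R p"
    by (simp add: g rpower_argmax_def)
  have snd_g: "snd g $ i = - ((\<alpha> $ i * (1 + ?x) + 1) / r $ i)" for i
    by (simp add: g rpower_argmax_def gradient_numer_def)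
  have yhat: "norm p * yhat = ?x"
  proof (cases "p = 0")
    case True
    then show ?thesis using slope(3) by simp
  next
    case False
    then show ?thesis
      unfolding yhat_def norm_times_root_def by (rule rpower_root(2)[OF \<alpha> sum1 r dual])
  qed
  have part1: "fst g $ i = of_bool (p \<noteq> 0) * yhat * (p $ i / norm p)" for i
  proof (cases "p = 0")
    case False
    have "norm p * (?\<eta> * norm p) = norm p * yhat"
      using slope(3) yhat by (simp add: power2_eq_square mult_ac)
    then have "?\<eta> * norm p = yhat" using False by simp
    then show ?thesis using False by (simp add: fst_g flip: \<open>?\<eta> * norm p = yhat\<close>)
  qed (simp add: fst_g)
  have geom: "(p $ j > 0 \<longrightarrow> fst g $ j = rgeom_y_minus d \<phi> (p $ j)) \<and>
           (p $ j = 0 \<longrightarrow> fst g $ j = 0) \<and>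
           (p $ j < 0 \<longrightarrow> fst g $ j = - rgeom_y_minus d \<phi> (- (p $ j))) \<and>
           (\<forall>i. snd g $ i = - inverse (r $ i) *
              (((p $ j)\<^sup>2 + sqrt (\<phi> * (d\<^sup>2 * \<phi> + d\<^sup>2 * (p $ j)\<^sup>2 - (p $ j)\<^sup>2)))
                 / (\<phi> * d\<^sup>2 - (p $ j)\<^sup>2) + 1))"
    if card: "CARD('d1) = 1" and \<alpha>_eq: "\<forall>i. \<alpha> $ i = 1 / d" for j
  proof -
    define q where "q = p $ j"
    define R where "R = (q\<^sup>2 + sqrt (\<phi> * (d\<^sup>2 * \<phi> + d\<^sup>2 * q\<^sup>2 - q\<^sup>2))) / (\<phi> * d\<^sup>2 - q\<^sup>2)"
    have d: "0 < d" by (simp add: d_def)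
    have single: "(UNIV :: 'd1 set) = {j}" using card by (metis UNIV_I card_1_singletonE singletonD)
    have norm_p: "(norm p)\<^sup>2 = q\<^sup>2"
      unfolding power2_norm_eq_inner inner_vec_def single by (simp add: q_def power2_eq_square)
    have "\<alpha> = (\<chi> i. 1 / d)" using \<alpha>_eq by (simp add: vec_eq_iff)
    then have "power_prod \<alpha> \<alpha> = (1 / d)\<^sup>2"
      using power_prod_const[OF \<alpha> sum1, of "1 / d"] d by simp
    then have disc: "q\<^sup>2 < \<phi> * d\<^sup>2"
      using dual d by (simp add: norm_p \<phi>_def power_divide divide_less_eq)
    have "gradient_numer \<alpha> ?x = (\<chi> i. (1 + ?x) / d + 1)"
      using \<alpha>_eq by (simp add: gradient_numer_def vec_eq_iff)
    then have scaling: "power_prod \<alpha> (gradient_numer \<alpha> ?x) = ((1 + ?x) / d + 1)\<^sup>2"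
      using power_prod_const[OF \<alpha> sum1] slope(1) d by (simp add: add_pos_pos)
    have "?x * (\<phi> * (?x + 2)) = q\<^sup>2 * ((1 + ?x) / d + 1)\<^sup>2"
      using slope(3) \<phi> slope(1)
      by (simp add: norm_p rpower_slope_def scaling \<phi>_def[symmetric] divide_eq_eq mult_ac)
    also have "((1 + ?x) / d + 1)\<^sup>2 = (d + (1 + ?x))\<^sup>2 / d\<^sup>2"
      using d by (simp add: field_simps power2_eq_square)
    finally have "q\<^sup>2 * (d + (1 + ?x))\<^sup>2 = d\<^sup>2 * \<phi> * ((1 + ?x)\<^sup>2 - 1)"
      using d by (simp add: field_simps power2_eq_square)
    then have x: "1 + ?x = d * R"
      unfolding R_def using d slope(1) disc by (intro rgeom_quadratic_root) auto
    have snd_eq: "snd g $ i = - inverse (r $ i) * (R + 1)" for i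
      unfolding snd_g x using \<alpha>_eq d by (simp add: divide_inverse)
    \<comment> \<open>applied to \<open>c = q\<close> or \<open>c = - q\<close>, whichever is positive\<close>
    have y_minus: "rgeom_y_minus d \<phi> c = (d * R - 1) / c" if c: "0 < c" "c\<^sup>2 = q\<^sup>2" for c
    proof -
      let ?s = "\<phi> * (d\<^sup>2 * \<phi> + d\<^sup>2 * c\<^sup>2 - c\<^sup>2)"
      have "\<phi> * (d\<^sup>2 / c\<^sup>2 * \<phi> + d\<^sup>2 - 1) = ?s / c\<^sup>2"
        using c(1) by (simp add: field_simps)
      then have "sqrt (\<phi> * (d\<^sup>2 / c\<^sup>2 * \<phi> + d\<^sup>2 - 1)) = sqrt ?s / c"
        using c(1) by (simp add: real_sqrt_divide)
      moreover have "c + sqrt ?s / c = (c\<^sup>2 + sqrt ?s) / c"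
        using c(1) by (simp add: field_simps power2_eq_square)
      ultimately show ?thesis
        by (simp add: rgeom_y_minus_def R_def c(2)[symmetric] divide_inverse algebra_simps)
    qed
    have fst_eq: "fst g $ j = (d * R - 1) / q" if "q \<noteq> 0"
    proof -
      have "?\<eta> * q * q = d * R - 1"
        using slope(3)[unfolded norm_p] x by (simp add: power2_eq_square mult.assoc)
      then show ?thesis using that by (simp add: fst_g q_def[symmetric] eq_divide_eq)
    qed
    show ?thesis
      unfolding q_def[symmetric] R_def[symmetric]
      using snd_eq fst_eq y_minus[of q] y_minus[of "- q"] by (auto simp: fst_g q_def)
  qed
  show ?thesis
    using grad part1 geom rpower_root(1)[OF \<alpha> sum1 r dual]
    unfolding g[symmetric] snd_g yhat by blast
qed

end
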